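(* Let $m,k\ge 1$ be integers and $0<\alpha<1$. Under the scaled Rayleigh model with prior $\pi_1(\sigma)\propto 1/\sigma$, the predictive density $f^*_{U_{m(k)}}(u|\mathbf{x})$ is unimodal, and the highest posterior density prediction interval (HPD PI) $(w_1,w_2)$, $0<w_1<w_2$, for $U_{m(k)}$ given $\mathbf{x}$ with coverage probability $1-\alpha$ is the simultaneous solution of $$\frac{1}{B(d,m)}\int_{p_k(w_2;\mathbf{x})}^{p_k(w_1;\mathbf{x})}t^{d-1}(1-t)^{m-1}\,dt=1-\alpha$$ and $$\left(\frac{w_1}{w_2}\right)^{2m-1}=\left(\frac{\delta(\mathbf{x})+k w_1^2}{\delta(\mathbf{x})+k w_2^2}\right)^{d+m},$$ where $\delta(\mathbf{x})=\sum_{i=1}^d x_i^2+(n-d)T_0^2$ and $p_k(y;\mathbf{x})=\dfrac{\delta(\mathbf{x})}{\delta(\mathbf{x})+k y^2}$.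
   Context: Model. $n$ iid component lifetimes have density $f(x;\sigma)=\frac{x}{\sigma}\exp\{-x^2/(2\sigma)\}$, $x>0$ (scaled Rayleigh distribution, $\sigma>0$ unknown). They are observed under Type-I hybrid censoring with pre-fixed integer $1\le r\le n$ and time $T>0$: the test stops at $T_0=\min\{x_{r:n},T\}$, where $x_{1:n}<\cdots<x_{n:n}$ are the ordered lifetimes; $d=\max\{s: s\le r,\ x_{s:n}\le T\}$, assumed to satisfy $d\ge 1$; and the observed sample is $\mathbf{x}=(x_1,\ldots,x_d)=(x_{1:n},\ldots,x_{d:n})$. Thus $0<x_1<\cdots<x_d\le T_0$, and $T_0=x_d$ if $d=r$ while $T_0=T$ if $d<r$. The likelihood is $$L(\sigma|\mathbf{x})\propto \sigma^{-d}\Big[\prod_{i=1}^d x_i\Big]\exp\Big\{-\frac{1}{2\sigma}\Big[\sum_{i=1}^d x_i^2+(n-d)T_0^2\Big]\Big\}.$$ Posterior. $\pi_1^*(\sigma|\mathbf{x})$ is the probability density on $(0,\infty)$ proportional to $L(\sigma|\mathbf{x})\cdot\frac1\sigma$. Repair times. $U_{m(k)}$ is the $m$-th minimal repair time of a series system of $k$ independent identical components with the same lifetime distribution, independent of the sample given $\sigma$; its density given $\sigma$ is $$f_{U_{m(k)}}(u|\sigma)=\frac{k^m u^{2m-1}}{\Gamma(m)\sigma^m 2^{m-1}}\exp\Big\{-\frac{k u^2}{2\sigma}\Big\},\qquad u>0.$$ The predictive density is $f^*_{U_{m(k)}}(u|\mathbf{x})=\int_0^\infty f_{U_{m(k)}}(u|\sigma)\pi_1^*(\sigma|\mathbf{x})\,d\sigma$,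 $u>0$. HPD PI. The HPD PI with coverage probability $1-\alpha$ is the interval having predictive probability $1-\alpha$ such that the predictive density at every point inside it is greater than the predictive density at every point outside it (points of the support outside the interval; endpoints are immaterial). $B(\cdot,\cdot)$ is the complete beta function. *)

theory Defs
  imports "HOL-Analysis.Analysis"
begin

section \<open>Scaled Rayleigh lifetimes under Type-I hybrid censoring\<close>

definition rayleigh_density :: "real \<Rightarrow> real \<Rightarrow> real" where
  "rayleigh_density \<sigma> u = u / \<sigma> * exp (- u\<^sup>2 / (2 * \<sigma>))"

text \<open>
  Throughout, \<open>x s\<close> for \<open>s \<in> {1..n}\<close> is the \<open>s\<close>-th smallest of the \<open>n\<close> lifetimes, of which only
  those with \<open>s \<le> d\<close> are observed. Adjoining \<open>0\<close> makes the maximum meaningful when no failure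
  occurs before \<open>T\<close>; the number of observed failures is then \<open>0\<close>.
\<close>

definition hybrid_d :: "nat \<Rightarrow> real \<Rightarrow> (nat \<Rightarrow> real) \<Rightarrow> nat" where
  "hybrid_d r T x = Max (insert 0 {s \<in> {1..r}. x s \<le> T})"

definition hybrid_T0 :: "nat \<Rightarrow> real \<Rightarrow> (nat \<Rightarrow> real) \<Rightarrow> real" where
  "hybrid_T0 r T x = min (x r) T"

definition hybrid_delta :: "nat \<Rightarrow> nat \<Rightarrow> real \<Rightarrow> (nat \<Rightarrow> real) \<Rightarrow> real" where
  "hybrid_delta n r T x =
     (\<Sum>i = 1..hybrid_d r T x. (x i)\<^sup>2) + (real n - real (hybrid_d r T x)) * (hybrid_T0 r T x)\<^sup>2"

text \<open>
  The likelihood is fixed only up to a factor independent of \<open>\<sigma>\<close>, which cancels in the normalised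
  posterior; the factor \<open>n! / (n - d)!\<close> is dropped here.
\<close>

definition hybrid_likelihood :: "nat \<Rightarrow> nat \<Rightarrow> real \<Rightarrow> (nat \<Rightarrow> real) \<Rightarrow> real \<Rightarrow> real" where
  "hybrid_likelihood n r T x \<sigma> =
     1 / \<sigma> ^ hybrid_d r T x * (\<Prod>i = 1..hybrid_d r T x. x i)
       * exp (- (1 / (2 * \<sigma>)) * hybrid_delta n r T x)"

lemma rayleigh_survival:
  assumes "\<sigma> > 0" "a \<ge> 0"
  shows "(LBINT u:{a..}. rayleigh_density \<sigma> u) = exp (- a\<^sup>2 / (2 * \<sigma>))"
proof -
  have "(\<integral>\<^sup>+u. ennreal (rayleigh_density \<sigma> u) * indicator {a..} u \<partial>lborel)
      = ennreal (0 - (- exp (- a\<^sup>2 / (2 * \<sigma>))))"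
  proof (rule nn_integral_FTC_atLeast)
    show "rayleigh_density \<sigma> \<in> borel_measurable borel"
      unfolding rayleigh_density_def by measurable
    show "((\<lambda>u. - exp (- u\<^sup>2 / (2 * \<sigma>))) has_real_derivative rayleigh_density \<sigma> u) (at u)" for u
      unfolding rayleigh_density_def using assms
      by (auto intro!: derivative_eq_intros)
    show "0 \<le> rayleigh_density \<sigma> u" if "a \<le> u" for u
      using assms that by (simp add: rayleigh_density_def)
    have "filterlim (\<lambda>u. u\<^sup>2 * (1 / (2 * \<sigma>))) at_top (at_top :: real filter)"
      using assms
      by (intro filterlim_at_top_mult_tendsto_pos[OF tendsto_const] filterlim_pow_at_top)
         (auto simp: filterlim_ident)
    then have "filterlim (\<lambda>u. - (u\<^sup>2 * (1 / (2 * \<sigma>)))) at_bot (at_top :: real filter)"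
      by (simp add: filterlim_uminus_at_bot)
    then have "((\<lambda>u. exp (- (u\<^sup>2 * (1 / (2 * \<sigma>))))) \<longlongrightarrow> 0) (at_top :: real filter)"
      by (rule filterlim_compose[OF exp_at_bot])
    then show "((\<lambda>u. - exp (- u\<^sup>2 / (2 * \<sigma>))) \<longlongrightarrow> 0) (at_top :: real filter)"
      by (auto intro: tendsto_eq_intros)
  qed
  also have "(\<integral>\<^sup>+u. ennreal (rayleigh_density \<sigma> u) * indicator {a..} u \<partial>lborel)
      = (\<integral>\<^sup>+u. ennreal (indicat_real {a..} u *\<^sub>R rayleigh_density \<sigma> u) \<partial>lborel)"
    by (intro nn_integral_cong) (auto simp: indicator_def)
  finally show ?thesis
    unfolding set_lebesgue_integral_def using assms
    by (subst integral_eq_nn_integral)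
       (auto simp: rayleigh_density_def indicator_def)
qed

lemma hybrid_likelihood_eq:
  assumes "\<sigma> > 0" "hybrid_d r T x \<le> n" "hybrid_T0 r T x \<ge> 0"
  shows "hybrid_likelihood n r T x \<sigma> =
    (\<Prod>i = 1..hybrid_d r T x. rayleigh_density \<sigma> (x i))
      * (LBINT u:{hybrid_T0 r T x..}. rayleigh_density \<sigma> u) ^ (n - hybrid_d r T x)"
proof -
  let ?d = "hybrid_d r T x"
  have "(\<Prod>i = 1..?d. rayleigh_density \<sigma> (x i))
      = 1 / \<sigma> ^ ?d * (\<Prod>i = 1..?d. x i) * exp (\<Sum>i = 1..?d. - (x i)\<^sup>2 / (2 * \<sigma>))"
    by (simp add: rayleigh_density_def prod.distrib prod_dividef exp_sum)
  moreover have "(LBINT u:{hybrid_T0 r T x..}. rayleigh_density \<sigma> u) ^ (n - ?d)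
      = exp ((real n - real ?d) * (- (hybrid_T0 r T x)\<^sup>2 / (2 * \<sigma>)))"
    using assms by (simp add: rayleigh_survival exp_of_nat_mult[symmetric] of_nat_diff)
  moreover have "- (1 / (2 * \<sigma>)) * hybrid_delta n r T x
      = (\<Sum>i = 1..?d. - (x i)\<^sup>2 / (2 * \<sigma>)) + (real n - real ?d) * (- (hybrid_T0 r T x)\<^sup>2 / (2 * \<sigma>))"
    by (simp add: hybrid_delta_def sum_divide_distrib[symmetric] sum_negf add_divide_distrib)
  ultimately show ?thesis
    unfolding hybrid_likelihood_def by (simp only: exp_add mult.assoc)
qed

section \<open>Posterior and predictive densities\<close>

definition posterior :: "(real \<Rightarrow> real) \<Rightarrow> (real \<Rightarrow> real) \<Rightarrow> real \<Rightarrow> real" where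
  "posterior L prior \<sigma> = L \<sigma> * prior \<sigma> / (LBINT s:{0<..}. L s * prior s)"

definition repair_density :: "nat \<Rightarrow> nat \<Rightarrow> real \<Rightarrow> real \<Rightarrow> real" where
  "repair_density m k \<sigma> u =
     real k ^ m * u ^ (2 * m - 1) / (Gamma (real m) * \<sigma> ^ m * 2 ^ (m - 1))
       * exp (- (real k * u\<^sup>2 / (2 * \<sigma>)))"

definition predictive_density ::
    "nat \<Rightarrow> nat \<Rightarrow> real \<Rightarrow> (nat \<Rightarrow> real) \<Rightarrow> nat \<Rightarrow> nat \<Rightarrow> real \<Rightarrow> real" where
  "predictive_density n r T x m k u =
     (LBINT \<sigma>:{0<..}. repair_density m k \<sigma> u
        * posterior (hybrid_likelihood n r T x) (\<lambda>s. 1 / s) \<sigma>)"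

definition p_fun :: "nat \<Rightarrow> nat \<Rightarrow> real \<Rightarrow> (nat \<Rightarrow> real) \<Rightarrow> nat \<Rightarrow> real \<Rightarrow> real" where
  "p_fun n r T x k y = hybrid_delta n r T x / (hybrid_delta n r T x + real k * y\<^sup>2)"

section \<open>Unimodality and highest density intervals\<close>

definition unimodal_on :: "real set \<Rightarrow> (real \<Rightarrow> real) \<Rightarrow> bool" where
  "unimodal_on S f \<longleftrightarrow>
     (\<exists>M\<in>S. strict_mono_on (S \<inter> {..M}) f \<and> strict_antimono_on (S \<inter> {M..}) f)"

text \<open>
  \<open>is_HPD_interval S f \<gamma> I\<close>: for a density \<open>f\<close> with support \<open>S\<close>, the interval \<open>I\<close> (of any kind,
  possibly unbounded) has probability \<open>\<gamma>\<close> and the density is larger inside \<open>I\<close> than outside.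
  Passing to interior and closure leaves the endpoints unconstrained.
\<close>

definition is_HPD_interval :: "real set \<Rightarrow> (real \<Rightarrow> real) \<Rightarrow> real \<Rightarrow> real set \<Rightarrow> bool" where
  "is_HPD_interval S f \<gamma> I \<longleftrightarrow>
     is_interval I \<and> I \<subseteq> S \<and> (LBINT u:I. f u) = \<gamma> \<and>
     (\<forall>u \<in> interior I. \<forall>v \<in> S - closure I. f v < f u)"

end

theory Submission
  imports Defs
begin

text \<open>
  The posterior of \<open>\<sigma>\<close> is inverse gamma with parameters \<open>d\<close> and \<open>\<delta> / 2\<close>, and the density of the repair
  time is of inverse gamma type in \<open>\<sigma>\<close>. Hence the mixture can be integrated in closed form
  (\<open>predictive_density_eq\<close>): with \<open>q u = \<delta> + k * u\<^sup>2\<close> it is a constant multiple of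
  \<open>u ^ (2 * m - 1) / q u ^ (d + m)\<close>. Thus the equation between powers of \<open>w1 / w2\<close> and of
  \<open>q w1 / q w2\<close> says precisely that the predictive density takes the same value at both ends of the
  interval.

  Under the substitution \<open>t = p u = \<delta> / q u\<close> the predictive density turns into the \<open>Beta d m\<close>
  density, so if \<open>P\<close> is an antiderivative of \<open>t ^ (d - 1) * (1 - t) ^ (m - 1)\<close>, then
  \<open>F u = (P 1 - P (p u)) / Beta d m\<close> is the distribution function. The incomplete beta integral in
  the other equation is therefore \<open>F w2 - F w1\<close>, the predictive probability of the interval.

  What remains is a fact about any continuous density \<open>f\<close> on \<open>{0<..}\<close> that increases strictly up to a
  mode, decreases strictly afterwards and tends to \<open>0\<close> at both ends of its support. The set where \<open>f\<close>
  exceeds a positive level below its maximum is an interval with equal values of \<open>f\<close> at its ends, and conversely.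
  \<^item> Existence (\<open>equal_ends_exist\<close>): slide an interval of fixed probability from left to right. At
    first its left end lies where \<open>f\<close> is nearly zero, at last its right end does, so somewhere in
    between the two end values agree.
  \<^item> Uniqueness (\<open>equal_ends_unique\<close>): two superlevel sets are nested, and the larger one has strictly
    larger probability.
  \<^item> Highest density (\<open>HPD_iff\<close>): an interval on which \<open>f\<close> is larger than elsewhere is comparable
    with every superlevel set, so having the same probability it agrees with it up to the endpoints.
\<close>

section \<open>Intervals of given probability under a unimodal density\<close>

text \<open>
  The distribution function \<open>F\<close> is a parameter, characterised as the antiderivative of \<open>f\<close> with
  limits \<open>0\<close> and \<open>1\<close>. Integrability of \<open>f\<close> and its total mass \<open>1\<close> follow from the fundamental
  theorem of calculus.
\<close>

locale unimodal_density =
  fixes f F :: "real \<Rightarrow> real" and M :: real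
  assumes M_pos: "0 < M"
    and F_deriv: "0 < u \<Longrightarrow> (F has_real_derivative f u) (at u)"
    and f_cont: "0 < u \<Longrightarrow> isCont f u"
    and f_pos: "0 < u \<Longrightarrow> 0 < f u"
    and f_incr: "0 < u \<Longrightarrow> u < v \<Longrightarrow> v \<le> M \<Longrightarrow> f u < f v"
    and f_decr: "M \<le> u \<Longrightarrow> u < v \<Longrightarrow> f v < f u"
    and f_0: "(f \<longlongrightarrow> 0) (at_right 0)"
    and f_inf: "(f \<longlongrightarrow> 0) at_top"
    and F_0: "(F \<longlongrightarrow> 0) (at_right 0)"
    and F_inf: "(F \<longlongrightarrow> 1) at_top"
begin

lemma unimodal: "unimodal_on {0<..} f"
  unfolding unimodal_on_def
proof (intro bexI conjI)
  show "M \<in> {0<..}" using M_pos by simp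
  show "strict_mono_on ({0<..} \<inter> {..M}) f"
    by (rule strict_mono_onI) (use f_incr in auto)
  show "strict_antimono_on ({0<..} \<inter> {M..}) f"
    by (rule monotone_onI) (use f_decr in auto)
qed

text \<open>Equal end values force the mode to lie strictly inside, so both monotone branches are available.\<close>

lemma superlevel:
  assumes "0 < a" "a < b" "f a = f b" "0 < u"
  shows "f a < f u \<longleftrightarrow> u \<in> {a<..<b}" and "f u < f a \<longleftrightarrow> u \<notin> {a..b}"
proof -
  have M: "a < M" "M < b"
    using f_incr[of a b] f_decr[of a b] assms by force+
  have in_I: "f a < f u" if "u \<in> {a<..<b}"
    using f_incr[of a u] f_decr[of u b] assms that by (cases "u \<le> M") auto
  have out_I: "f u < f a" if "u \<notin> {a..b}"
    using f_incr[of u a] f_decr[of b u] assms that M by (cases "u < a") auto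
  consider "u \<in> {a<..<b}" | "u \<notin> {a..b}" | "u = a \<or> u = b" by fastforce
  then have "(f a < f u \<longleftrightarrow> u \<in> {a<..<b}) \<and> (f u < f a \<longleftrightarrow> u \<notin> {a..b})"
  proof cases
    case 1 with in_I[OF 1] show ?thesis by auto
  next
    case 2 with out_I[OF 2] show ?thesis by auto
  next
    case 3 with assms(2,3) show ?thesis by auto
  qed
  then show "f a < f u \<longleftrightarrow> u \<in> {a<..<b}" "f u < f a \<longleftrightarrow> u \<notin> {a..b}" by blast+
qed

lemma quasiconcave:
  assumes "0 < a" "a \<le> u" "u \<le> b"
  shows "min (f a) (f b) \<le> f u"
proof (cases "u \<le> M")
  case True
  then have "f a \<le> f u" using f_incr[of a u] assms by (cases "a = u") (simp_all add: less_imp_le)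
  then show ?thesis by simp
next
  case False
  then have "f b \<le> f u" using f_decr[of u b] assms by (cases "u = b") (simp_all add: less_imp_le)
  then show ?thesis by simp
qed

lemma F_strict_mono:
  assumes "0 < a" "a < b"
  shows "F a < F b"
proof (rule DERIV_pos_imp_increasing[OF assms(2)])
  fix u assume "a \<le> u"
  with assms have "0 < u" by simp
  then show "\<exists>y. (F has_real_derivative y) (at u) \<and> 0 < y" using F_deriv f_pos by blast
qed

lemma F_less_iff: "0 < a \<Longrightarrow> 0 < b \<Longrightarrow> F a < F b \<longleftrightarrow> a < b"
  using F_strict_mono[of a b] F_strict_mono[of b a] by (metis less_asym' linorder_less_linear)

lemma F_cont: "0 < u \<Longrightarrow> isCont F u"
  using F_deriv DERIV_isCont by blast

text \<open>
  Together with strict monotonicity this yields a quantile function, whose continuity comes for free: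
  it is monotone with open range.
\<close>

lemma F_range: "bij_betw F {0<..} {0<..<1}"
  unfolding bij_betw_def
proof (intro conjI set_eqI iffI)
  show "inj_on F {0<..}"
    by (rule inj_onI) (metis F_less_iff greaterThan_iff less_irrefl linorder_less_linear)
next
  fix y assume "y \<in> F ` {0<..}"
  then obtain u where u: "0 < u" "y = F u" by auto
  have "0 \<le> F (u / 2)"
  proof (rule tendsto_upperbound[OF F_0])
    show "\<forall>\<^sub>F v in at_right 0. F v \<le> F (u / 2)"
      using eventually_at_right_real[of 0 "u / 2"] u
      by (auto elim!: eventually_mono intro!: less_imp_le F_strict_mono)
  qed auto
  moreover have "F (2 * u) \<le> 1"
  proof (rule tendsto_lowerbound[OF F_inf])
    show "\<forall>\<^sub>F v in at_top. F (2 * u) \<le> F v"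
      using eventually_gt_at_top[of "2 * u"]
      by eventually_elim (use u in \<open>simp add: less_imp_le F_strict_mono\<close>)
  qed auto
  ultimately show "y \<in> {0<..<1}"
    using u F_strict_mono[of "u/2" u] F_strict_mono[of u "2*u"] by auto
next
  fix y :: real assume y: "y \<in> {0<..<1}"
  have "\<forall>\<^sub>F u in at_right 0. F u < y \<and> 0 < u"
    using order_tendstoD(2)[OF F_0, of y] eventually_at_right_less[of 0] y
    by (auto elim: eventually_elim2)
  then obtain a where a: "F a < y" "0 < a"
    using eventually_happens[of _ "at_right (0::real)"] by auto
  have "\<forall>\<^sub>F u in at_top. y < F u \<and> 0 < u"
    using order_tendstoD(1)[OF F_inf, of y] eventually_gt_at_top[of 0] y
    by (simp add: eventually_conj)
  then obtain b where b: "y < F b" "0 < b"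
    using eventually_happens[of _ "at_top :: real filter"] by auto
  have "a < b" using a b F_less_iff by force
  then obtain u where "a \<le> u" "F u = y"
    using IVT'[of F a y b] a b F_cont by (force intro!: continuous_at_imp_continuous_on)
  with a show "y \<in> F ` {0<..}" by force
qed

lemma quantile:
  obtains Q where "\<And>p. p \<in> {0<..<1} \<Longrightarrow> 0 < Q p \<and> F (Q p) = p"
    and "\<And>u. 0 < u \<Longrightarrow> Q (F u) = u" and "continuous_on {0<..<1} Q"
proof
  let ?Q = "inv_into {0<..} F"
  show Q: "0 < ?Q p \<and> F (?Q p) = p" if "p \<in> {0<..<1}" for p
    using bij_betw_inv_into_right[OF F_range that] bij_betwE[OF bij_betw_inv_into[OF F_range]] that
    by auto
  show "?Q (F u) = u" if "0 < u" for u
    using bij_betw_inv_into_left[OF F_range] that by simp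
  show "continuous_on {0<..<1} ?Q"
  proof (rule continuous_onI_mono)
    have "?Q ` {0<..<1} = {0<..}"
      using bij_betw_inv_into[OF F_range] by (simp add: bij_betw_def)
    then show "open (?Q ` {0<..<1})" by simp
    show "?Q p \<le> ?Q q" if "p \<in> {0<..<1}" "q \<in> {0<..<1}" "p \<le> q" for p q
      using Q[OF that(1)] Q[OF that(2)] F_less_iff that(3) by (metis not_less)
  qed
qed

lemma F_bounds: "0 < u \<Longrightarrow> 0 < F u \<and> F u < 1"
  using bij_betwE[OF F_range] by auto

text \<open>
  With a quantile function \<open>Q\<close>, the intervals of probability \<open>\<gamma>\<close> are those from \<open>Q p\<close> to \<open>Q (p + \<gamma>)\<close>
  with \<open>0 < p < 1 - \<gamma>\<close>. The intermediate value theorem is applied to the difference \<open>\<Phi> p\<close> of the end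
  values. Near either end of the range of \<open>p\<close>, one endpoint of the interval stays in a fixed compact
  part of the support, where \<open>quasiconcave\<close> bounds \<open>f\<close> below, while \<open>f\<close> tends to \<open>0\<close> at the other.
\<close>

lemma equal_ends_exist:
  assumes "0 < \<gamma>" "\<gamma> < 1"
  obtains a b where "0 < a" "a < b" "f a = f b" "F b - F a = \<gamma>"
proof -
  obtain Q where Q: "\<And>p. p \<in> {0<..<1} \<Longrightarrow> 0 < Q p \<and> F (Q p) = p"
    and QF: "\<And>u. 0 < u \<Longrightarrow> Q (F u) = u" and Q_cont: "continuous_on {0<..<1} Q"
    using quantile by blast
  define h where "h = (1 - \<gamma>) / 2"
  define \<Phi> where "\<Phi> p = f (Q p) - f (Q (p + \<gamma>))" for p
  have h: "0 < h" "h + h = 1 - \<gamma>" "h + \<gamma> < 1" using assms by (auto simp: h_def field_simps)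
  have Q_mono: "Q p < Q q \<longleftrightarrow> p < q" if "p \<in> {0<..<1}" "q \<in> {0<..<1}" for p q
    using F_less_iff[of "Q p" "Q q"] Q that by auto
  have fQ_cont: "continuous_on {0<..<1} (\<lambda>p. f (Q p))"
    by (rule continuous_on_compose2[OF _ Q_cont, of "{0<..}" f])
       (use Q f_cont in \<open>auto intro!: continuous_at_imp_continuous_on\<close>)
  have \<Phi>_cont: "continuous_on {0<..<1 - \<gamma>} \<Phi>"
    unfolding \<Phi>_def
    by (intro continuous_on_diff continuous_on_compose2[OF fQ_cont, of _ "\<lambda>p. p"]
        continuous_on_compose2[OF fQ_cont, of _ "\<lambda>p. p + \<gamma>"] continuous_intros) (use assms in auto)
  \<comment> \<open>The right end lies between \<open>Q \<gamma>\<close> and \<open>Q (h + \<gamma>)\<close>, while the left end is close to \<open>0\<close>.\<close>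
  obtain p where p: "0 < p" "p < h" "\<Phi> p < 0"
  proof -
    define c where "c = min (f (Q \<gamma>)) (f (Q (h + \<gamma>)))"
    have "0 < c" using Q assms h f_pos by (auto simp: c_def)
    then have "\<forall>\<^sub>F u in at_right 0. f u < c \<and> 0 < u \<and> u < Q h"
      using order_tendstoD(2)[OF f_0, of c] eventually_at_right_less[of 0]
        eventually_at_right_real[of 0 "Q h"] Q[of h] h assms
      by (auto elim!: eventually_elim2 intro!: eventually_conj)
    then obtain a where a: "f a < c" "0 < a" "a < Q h"
      using eventually_happens[of _ "at_right (0::real)"] by auto
    have Fa: "F a \<in> {0<..<1}" "F a < h"
      using F_bounds[OF a(2)] F_less_iff[of a "Q h"] a Q[of h] h assms by auto
    have "c \<le> f (Q (F a + \<gamma>))"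
      unfolding c_def
      by (rule quasiconcave) (use Q_mono[of "F a + \<gamma>" \<gamma>] Q_mono[of "h + \<gamma>" "F a + \<gamma>"]
          Q[of \<gamma>] Fa h assms in \<open>auto simp: not_less[symmetric]\<close>)
    then show ?thesis using that[of "F a"] a Fa QF by (simp add: \<Phi>_def)
  qed
  \<comment> \<open>The left end lies between \<open>Q h\<close> and \<open>Q (1 - \<gamma>)\<close>, while the right end is far out.\<close>
  obtain q where q: "h < q" "q < 1 - \<gamma>" "0 < \<Phi> q"
  proof -
    define c where "c = min (f (Q h)) (f (Q (1 - \<gamma>)))"
    have "0 < c" using Q assms h f_pos by (auto simp: c_def)
    then have "\<forall>\<^sub>F u in at_top. f u < c \<and> Q (h + \<gamma>) < u"
      using order_tendstoD(2)[OF f_inf, of c] eventually_gt_at_top[of "Q (h + \<gamma>)"]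
      by (auto elim!: eventually_elim2)
    then obtain b where b: "f b < c" "Q (h + \<gamma>) < b"
      using eventually_happens[of _ "at_top :: real filter"] by auto
    have b0: "0 < b" using b Q[of "h + \<gamma>"] h assms by auto
    have Fb: "F b < 1" "h + \<gamma> < F b"
      using F_bounds[OF b0] F_less_iff[of "Q (h + \<gamma>)" b] b b0 Q[of "h + \<gamma>"] h assms by auto
    have "c \<le> f (Q (F b - \<gamma>))"
      unfolding c_def
      by (rule quasiconcave) (use Q_mono[of "F b - \<gamma>" h] Q_mono[of "1 - \<gamma>" "F b - \<gamma>"]
          Q[of h] Fb h assms in \<open>auto simp: not_less[symmetric]\<close>)
    then show ?thesis using that[of "F b - \<gamma>"] b b0 Fb QF by (simp add: \<Phi>_def)
  qed
  obtain z where z: "p \<le> z" "z \<le> q" "\<Phi> z = 0"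
    using IVT'[of \<Phi> p 0 q] p q continuous_on_subset[OF \<Phi>_cont, of "{p..q}"]
    by (auto simp: subset_eq)
  have *: "z \<in> {0<..<1}" "z + \<gamma> \<in> {0<..<1}" using z p q assms by auto
  show ?thesis
    by (rule that[of "Q z" "Q (z + \<gamma>)"]) (use * z Q Q_mono assms in \<open>auto simp: \<Phi>_def\<close>)
qed

text \<open>
  The interval with the lower end value contains the other one, and equality of the probabilities
  leaves no room between them.
\<close>

lemma equal_ends_unique:
  assumes "0 < a" "a < b" "f a = f b" "0 < a'" "a' < b'" "f a' = f b'"
    and "F b - F a = F b' - F a'"
  shows "a = a' \<and> b = b'"
proof -
  have nested: "a = a' \<and> b = b'"
    if *: "0 < a" "a < b" "f a = f b" "0 < a'" "a' < b'" "f a' = f b'"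
      "F b - F a = F b' - F a'" "f a \<le> f a'" for a b a' b'
  proof -
    have "a \<le> a'" "b' \<le> b"
      using superlevel(2)[of a b a'] superlevel(2)[of a b b'] * by auto
    moreover have "F a \<le> F a'" "F b' \<le> F b"
      using F_less_iff[of a' a] F_less_iff[of b b'] * \<open>a \<le> a'\<close> \<open>b' \<le> b\<close> by auto
    ultimately show ?thesis
      using F_less_iff[of a a'] F_less_iff[of b' b] * by auto
  qed
  show ?thesis
    using nested[of a b a' b'] nested[of a' b' a b] assms by (cases "f a \<le> f a'") auto
qed

lemma f_integrable: "set_integrable lborel {0<..} f"
proof -
  have "set_integrable lborel (einterval 0 \<infinity>) f"
  proof (rule interval_integral_FTC_nonneg)
    show "((F \<circ> real_of_ereal) \<longlongrightarrow> 0) (at_right 0)"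
      using F_0 by (simp add: ereal_tendsto_simps zero_ereal_def)
    show "((F \<circ> real_of_ereal) \<longlongrightarrow> 1) (at_left \<infinity>)"
      using F_inf by (simp add: ereal_tendsto_simps)
  qed (use F_deriv f_cont f_pos in \<open>auto intro!: AE_I2 less_imp_le\<close>)
  then show ?thesis by (simp add: zero_ereal_def)
qed

lemma mass_Ioo:
  assumes "0 < a" "a \<le> b"
  shows "(LBINT u:{a<..<b}. f u) = F b - F a"
proof -
  have "(LBINT u=a..b. f u) = F b - F a"
  proof (rule interval_integral_FTC_finite)
    show "continuous_on {min a b..max a b} f"
      using assms f_cont by (intro continuous_at_imp_continuous_on) auto
    fix u assume "min a b \<le> u"
    with assms have "0 < u" by linarith
    from F_deriv[OF this]
    show "(F has_vector_derivative f u) (at u within {min a b..max a b})"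
      by (simp add: has_real_derivative_iff_has_vector_derivative has_vector_derivative_at_within)
  qed
  then show ?thesis using assms by (simp add: interval_integral_Ioo)
qed

lemma integrable_on_part:
  assumes "A \<in> sets borel" "A \<subseteq> {0<..}"
  shows "set_integrable lborel A f"
  using set_integrable_subset[OF f_integrable] assms by simp

lemma mass_strict_mono:
  assumes "A \<in> sets borel" "B \<in> sets borel" "A \<subseteq> B" "B \<subseteq> {0<..}"
    and "p < q" "{p<..<q} \<subseteq> B - A"
  shows "(LBINT u:A. f u) < (LBINT u:B. f u)"
proof -
  \<comment> \<open>The middle third, so that \<open>0 < a\<close> even when \<open>p = 0\<close>.\<close>
  define a b where "a = (2 * p + q) / 3" and "b = (p + 2 * q) / 3"
  have ab: "a < b" "{a<..<b} \<subseteq> B - A" "a \<in> B"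
    using assms(5,6) unfolding a_def b_def by (auto simp: field_simps subset_eq)
  then have "0 < a" using assms(4) by auto
  have "B = (A \<union> {a<..<b}) \<union> (B - A - {a<..<b})" using assms ab by auto
  then have "(LBINT u:B. f u) = (LBINT u:A. f u) + (LBINT u:{a<..<b}. f u)
      + (LBINT u:B - A - {a<..<b}. f u)"
    using assms ab \<open>0 < a\<close>
    by (subst \<open>B = _\<close>, subst set_integral_Un; (subst set_integral_Un)?)
       (auto intro!: integrable_on_part simp del: Un_Diff_cancel)
  moreover have "0 \<le> (LBINT u:B - A - {a<..<b}. f u)"
    unfolding set_lebesgue_integral_def
    using assms(4) f_pos
    by (intro Bochner_Integration.integral_nonneg) (auto simp: indicator_def subset_eq less_imp_le)
  ultimately show ?thesis
    using mass_Ioo[of a b] F_strict_mono[of a b] ab \<open>0 < a\<close> by simp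
qed

lemma mass_between:
  assumes "0 < a" "a < b" "I \<in> sets borel" "{a<..<b} \<subseteq> I" "I \<subseteq> {a..b}"
  shows "(LBINT u:I. f u) = F b - F a"
proof -
  have "(LBINT u:I. f u) = (LBINT u:{a<..<b}. f u)"
  proof (rule set_integral_cong_set)
    have "AE u in lborel. u \<noteq> a" "AE u in lborel. u \<noteq> b" by (rule AE_lborel_singleton)+
    then show "AE u in lborel. u \<in> {a<..<b} \<longleftrightarrow> u \<in> I"
      by eventually_elim (use assms(4,5) in force)
    show "set_borel_measurable lborel {a<..<b} f" "set_borel_measurable lborel I f"
      using integrable_on_part[of "{a<..<b}"] integrable_on_part[of I] assms
      unfolding set_integrable_def set_borel_measurable_def
      by (force dest: borel_measurable_integrable)+
  qed
  with mass_Ioo assms show ?thesis by simp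
qed

lemma interior_nonempty_if_mass:
  assumes "is_interval I" "(LBINT u:I. f u) \<noteq> 0"
  shows "interior I \<noteq> {}"
proof
  assume empty: "interior I = {}"
  have "x = y" if "x \<in> I" "y \<in> I" for x y
  proof (rule ccontr)
    assume "x \<noteq> y"
    then obtain l u where lu: "l \<in> I" "u \<in> I" "l < u"
      using \<open>x \<in> I\<close> \<open>y \<in> I\<close> by (metis linorder_less_linear)
    have "{l<..<u} \<subseteq> interior I"
    proof (rule interior_maximal)
      show "{l<..<u} \<subseteq> I"
        using mem_is_interval_1_I[OF assms(1) lu(1,2)] by auto
    qed simp
    moreover have "{l<..<u} \<noteq> {}" using lu(3) by simp
    ultimately show False using empty by blast
  qed
  then obtain c where "I \<subseteq> {c}" by blast
  then have "AE u in lborel. indicator I u *\<^sub>R f u = 0"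
    using AE_lborel_singleton[of c] by (auto simp: indicator_def elim!: eventually_mono)
  then have "(LBINT u:I. f u) = 0"
    unfolding set_lebesgue_integral_def by (rule integral_eq_zero_AE)
  with assms(2) show False by simp
qed

lemma is_interval_between:
  assumes "{a<..<b} \<subseteq> I" "I \<subseteq> {a..b::real}"
  shows "is_interval I"
proof -
  have "u \<in> I" if "x \<in> I" "y \<in> I" "x \<le> u" "u \<le> y" for x y u
  proof (cases "u = x \<or> u = y")
    case False
    moreover have "a \<le> x" "y \<le> b" using assms(2) that by auto
    ultimately have "u \<in> {a<..<b}" using that by auto
    with assms(1) show ?thesis by blast
  qed (use that in auto)
  then show ?thesis unfolding is_interval_1 by blast
qed

text \<open>
  For the implication from left to right, let \<open>c = f a = f b\<close>, so that \<open>{a<..<b}\<close> is where \<open>f\<close>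
  exceeds \<open>c\<close>. If some interior point of \<open>I\<close> had density below \<open>c\<close>, then no point of density above
  \<open>c\<close> could be left out, so \<open>I\<close> would contain \<open>{a<..<b}\<close> and, in addition, a nontrivial interval outside: too
  much probability. So \<open>I\<close> lies within \<open>{a..b}\<close>, and leaving out a piece of it would give too little.
  Since intervals are convex, interior and closure determine each other.
\<close>

lemma HPD_iff:
  assumes "0 < a" "a < b" "f a = f b"
  shows "is_HPD_interval {0<..} f (F b - F a) I \<longleftrightarrow> {a<..<b} \<subseteq> I \<and> I \<subseteq> {a..b}"
proof
  assume I: "{a<..<b} \<subseteq> I \<and> I \<subseteq> {a..b}"
  have interval: "is_interval I" using is_interval_between I by blast
  have sub: "interior I \<subseteq> {a<..<b}" "{a..b} \<subseteq> closure I"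
    using interior_mono[of I "{a..b}"] closure_mono[of "{a<..<b}" I] I assms by auto
  show "is_HPD_interval {0<..} f (F b - F a) I"
    unfolding is_HPD_interval_def
  proof (intro conjI ballI)
    show "is_interval I" by (fact interval)
    show "I \<subseteq> {0<..}" using I assms by auto
    show "(LBINT u:I. f u) = F b - F a"
      using mass_between I assms real_interval_borel_measurable[OF interval] by blast
    fix u v assume uv: "u \<in> interior I" "v \<in> {0<..} - closure I"
    then have "u \<in> {a<..<b}" "v \<notin> {a..b}" "0 < u" "0 < v" using sub assms(1) by auto
    then have "f a < f u" "f v < f a" using superlevel[OF assms] by blast+
    then show "f v < f u" by simp
  qed
next
  assume "is_HPD_interval {0<..} f (F b - F a) I"
  then have interval: "is_interval I" and pos: "I \<subseteq> {0<..}"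
    and mass: "(LBINT u:I. f u) = F b - F a"
    and higher: "\<And>u v. u \<in> interior I \<Longrightarrow> v \<in> {0<..} - closure I \<Longrightarrow> f v < f u"
    by (auto simp: is_HPD_interval_def)
  have borel: "I \<in> sets borel" using interval by (rule real_interval_borel_measurable)
  have "convex I" using interval by (rule is_interval_convex)
  have Ioo_sub: "{a<..<b} \<subseteq> I" if "{a<..<b} \<subseteq> closure I"
  proof -
    have "{a<..<b} \<subseteq> interior (closure I)" using that by (rule interior_maximal) simp
    also have "\<dots> = interior I" using \<open>convex I\<close> by (rule convex_interior_closure)
    also have "\<dots> \<subseteq> I" by (rule interior_subset)
    finally show ?thesis .
  qed
  have nonempty: "interior I \<noteq> {}"
    by (rule interior_nonempty_if_mass[OF interval]) (use mass F_strict_mono[OF assms(1,2)] in simp)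
  have gap: "\<exists>p q. p < q \<and> {p<..<q} \<subseteq> S" if "open S" "u \<in> S" for S :: "real set" and u
  proof -
    obtain e where "0 < e" "ball u e \<subseteq> S" using openE[OF \<open>open S\<close> \<open>u \<in> S\<close>] .
    then show ?thesis
      by (intro exI[of _ "u - e"] exI[of _ "u + e"]) (simp add: ball_eq_greaterThanLessThan)
  qed
  have "interior I \<subseteq> {a..b}"
  proof (rule ccontr)
    assume "\<not> interior I \<subseteq> {a..b}"
    then obtain u where u: "u \<in> interior I" "u \<notin> {a..b}" by blast
    have "0 < u" using u(1) pos interior_subset[of I] by auto
    then have "f u < f a" using superlevel(2)[OF assms] u(2) by blast
    have "{a<..<b} \<subseteq> closure I"
    proof
      fix v assume v: "v \<in> {a<..<b}"
      with assms(1) have "0 < v" by simp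
      then have "f a < f v" using superlevel(1)[OF assms] v by blast
      with \<open>f u < f a\<close> have "\<not> f v < f u" by simp
      then show "v \<in> closure I" using higher[OF u(1), of v] \<open>0 < v\<close> by auto
    qed
    moreover obtain p q where "p < q" "{p<..<q} \<subseteq> interior I - {a..b}"
      using gap[of "interior I - {a..b}" u] u by (auto simp: open_Diff)
    moreover from this have "{p<..<q} \<subseteq> I - {a<..<b}"
      using interior_subset[of I] by auto
    ultimately have "(LBINT u:{a<..<b}. f u) < (LBINT u:I. f u)"
      using borel pos Ioo_sub by (intro mass_strict_mono[of _ _ p q]) simp_all
    with mass mass_Ioo[of a b] assms show False by simp
  qed
  then have "closure (interior I) \<subseteq> {a..b}" by (simp add: closure_minimal)
  then have upper: "I \<subseteq> {a..b}"
    using convex_closure_interior[OF \<open>convex I\<close> nonempty] closure_subset by blast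
  have "{a<..<b} \<subseteq> closure I"
  proof (rule ccontr)
    assume "\<not> {a<..<b} \<subseteq> closure I"
    then obtain v where v: "v \<in> {a<..<b} - closure I" by blast
    obtain p q where "p < q" "{p<..<q} \<subseteq> {a<..<b} - closure I"
      using gap[OF _ v] by (auto simp: open_Diff)
    moreover from this have "{p<..<q} \<subseteq> {a..b} - I"
      using closure_subset[of I] by force
    ultimately have "(LBINT u:I. f u) < (LBINT u:{a..b}. f u)"
      using upper borel assms(1) by (intro mass_strict_mono[of _ _ p q]) auto
    moreover have "(LBINT u:{a..b}. f u) = F b - F a"
      using assms(1,2) by (intro mass_between) auto
    ultimately show False using mass by simp
  qed
  with upper Ioo_sub show "{a<..<b} \<subseteq> I \<and> I \<subseteq> {a..b}" by blast
qed

theorem HPD_interval: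
  assumes "0 < \<gamma>" "\<gamma> < 1"
  shows "\<exists>a b. 0 < a \<and> a < b \<and>
    (\<forall>I. is_HPD_interval {0<..} f \<gamma> I \<longleftrightarrow> {a<..<b} \<subseteq> I \<and> I \<subseteq> {a..b}) \<and>
    (\<forall>u v. 0 < u \<and> u < v \<longrightarrow> (F v - F u = \<gamma> \<and> f u = f v \<longleftrightarrow> u = a \<and> v = b))"
proof -
  obtain a b where ab: "0 < a" "a < b" "f a = f b" and mass: "F b - F a = \<gamma>"
    using equal_ends_exist[OF assms] .
  show ?thesis
  proof (intro exI conjI allI impI)
    show "0 < a" "a < b" by (fact ab)+
    show "is_HPD_interval {0<..} f \<gamma> I \<longleftrightarrow> {a<..<b} \<subseteq> I \<and> I \<subseteq> {a..b}" for I
      using HPD_iff[OF ab] mass by simp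
    fix u v :: real assume uv: "0 < u \<and> u < v"
    show "F v - F u = \<gamma> \<and> f u = f v \<longleftrightarrow> u = a \<and> v = b"
      using equal_ends_unique[OF _ _ _ ab, of u v] uv ab mass by metis
  qed
qed

end


section \<open>The predictive density in closed form\<close>

text \<open>
  For \<open>y \<ge> 0\<close> this is the probability that a Poisson variable with mean \<open>y\<close> is at most \<open>a\<close>. Its
  derivative telescopes to a single term, which makes it an elementary antiderivative of the gamma
  density with integer shape.
\<close>

lemma has_derivative_poisson_tail:
  "((\<lambda>y. exp (- y) * (\<Sum>j\<le>a. y ^ j / fact j)) has_real_derivative
     - (exp (- y) * y ^ a / fact a)) (at y)"
proof (induction a)
  case 0
  show ?case by (auto intro!: derivative_eq_intros)
next
  case (Suc a)
  have "((\<lambda>y. y ^ Suc a / fact (Suc a)) has_real_derivative y ^ a / fact a) (at y)"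
    using DERIV_cdivide[OF DERIV_pow[of "Suc a" y UNIV], of "fact (Suc a)"]
    by (simp add: fact_Suc del: of_nat_Suc)
  moreover have "((\<lambda>y. exp (- y)) has_real_derivative - exp (- y)) (at y)"
    by (auto intro!: derivative_eq_intros)
  ultimately have "((\<lambda>y. exp (- y) * (y ^ Suc a / fact (Suc a))) has_real_derivative
      - exp (- y) * (y ^ Suc a / fact (Suc a)) + y ^ a / fact a * exp (- y)) (at y)"
    by (rule DERIV_mult[rotated])
  from DERIV_add[OF Suc this] show ?case
    by (simp add: distrib_left del: power_Suc fact_Suc)
qed

text \<open>
  Both the normalisation of the posterior and the predictive density are of this form. The
  substitution \<open>y = c / \<sigma>\<close> reduces it to the gamma density, so the preceding antiderivative
  evaluated at \<open>c / \<sigma>\<close> does the job.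
\<close>

lemma integral_inverse_gamma:
  fixes c :: real
  assumes "0 < c"
  shows "(LBINT \<sigma>:{0<..}. exp (- (c / \<sigma>)) / \<sigma> ^ (a + 2)) = fact a / c ^ Suc a"
proof -
  define E where "E y = exp (- y) * (\<Sum>j\<le>a. y ^ j / fact j)" for y :: real
  have E_deriv: "(E has_real_derivative - (exp (- y) * y ^ a / fact a)) (at y)" for y
    unfolding E_def by (rule has_derivative_poisson_tail)
  let ?G = "\<lambda>\<sigma>. fact a / c ^ Suc a * E (c / \<sigma>)"
  have E_inf: "(E \<longlongrightarrow> 0) at_top"
  proof -
    have "((\<lambda>y. \<Sum>j\<le>a. y ^ j / exp y / fact j) \<longlongrightarrow> (\<Sum>j\<le>a. 0 / fact j)) (at_top :: real filter)"
      by (intro tendsto_sum tendsto_divide tendsto_power_div_exp_0 tendsto_const) simp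
    then show ?thesis
      by (simp add: E_def[abs_def] exp_minus sum_distrib_left divide_simps)
  qed
  have E_cont: "isCont E 0" using E_deriv by (rule DERIV_isCont)
  have E_0: "E 0 = 1" by (simp add: E_def sum.atMost_shift)
  have "(LBINT \<sigma>=0..\<infinity>. exp (- (c / \<sigma>)) / \<sigma> ^ (a + 2)) = fact a / c ^ Suc a - 0"
  proof (rule interval_integral_FTC_nonneg(2))
    show "(?G has_real_derivative exp (- (c / \<sigma>)) / \<sigma> ^ (a + 2)) (at \<sigma>)"
      if "0 < ereal \<sigma>" for \<sigma>
      using that assms
      by (auto intro!: derivative_eq_intros DERIV_chain2[OF E_deriv]
          simp: zero_ereal_def field_simps power2_eq_square)
    show "isCont (\<lambda>\<sigma>. exp (- (c / \<sigma>)) / \<sigma> ^ (a + 2)) \<sigma>" if "0 < ereal \<sigma>" for \<sigma>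
      using that by (intro continuous_intros) (auto simp: zero_ereal_def)
    show "AE \<sigma> in lborel. 0 < ereal \<sigma> \<longrightarrow> ereal \<sigma> < \<infinity> \<longrightarrow> 0 \<le> exp (- (c / \<sigma>)) / \<sigma> ^ (a + 2)"
      by (auto simp: zero_ereal_def)
    have "filterlim (\<lambda>\<sigma>. c / \<sigma>) at_top (at_right 0)"
      using filterlim_tendsto_pos_mult_at_top[OF tendsto_const assms filterlim_inverse_at_top_right]
      by (simp add: field_simps)
    then have "((\<lambda>\<sigma>. ?G \<sigma>) \<longlongrightarrow> fact a / c ^ Suc a * 0) (at_right 0)"
      by (intro tendsto_mult tendsto_const filterlim_compose[OF E_inf])
    then show "((?G \<circ> real_of_ereal) \<longlongrightarrow> 0) (at_right 0)"
      by (simp add: ereal_tendsto_simps zero_ereal_def)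
    have "((\<lambda>\<sigma>. c / \<sigma>) \<longlongrightarrow> 0) at_top"
      by (intro tendsto_divide_0[OF tendsto_const] filterlim_at_top_imp_at_infinity filterlim_ident)
    then have "((\<lambda>\<sigma>. ?G \<sigma>) \<longlongrightarrow> fact a / c ^ Suc a * E 0) at_top"
      by (intro tendsto_mult tendsto_const isCont_tendsto_compose[OF E_cont])
    then show "((?G \<circ> real_of_ereal) \<longlongrightarrow> fact a / c ^ Suc a) (at_left \<infinity>)"
      by (simp add: ereal_tendsto_simps E_0)
  qed simp
  then show ?thesis
    by (simp add: interval_lebesgue_integral_0_infty)
qed

lemma Beta_Suc: "Beta (real (Suc a)) (real (Suc b)) = fact a * fact b / fact (Suc (a + b))"
  using Gamma_fact[of a, where 'a = real] Gamma_fact[of b, where 'a = real]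
    Gamma_fact[of "Suc (a + b)", where 'a = real]
  by (simp add: Beta_def add_ac)

text \<open>
  The number of failures and the repair index are written as successors, which avoids truncated
  subtraction in the exponents. Since \<open>\<delta> + k * u\<^sup>2\<close> is positive for every real \<open>u\<close>, the formula
  is an identity of functions on the whole line.
\<close>

lemma predictive_density_eq:
  assumes d: "hybrid_d r T x = Suc a"
    and \<delta>: "hybrid_delta n r T x = \<delta>" "0 < \<delta>"
    and x_pos: "0 < (\<Prod>i = 1..Suc a. x i)"
  shows "predictive_density n r T x (Suc b) k =
    (\<lambda>u. 2 * real k ^ Suc b * \<delta> ^ Suc a / Beta (Suc a) (Suc b)
      * (u ^ (2 * b + 1) / (\<delta> + real k * u\<^sup>2) ^ (a + b + 2)))"
proof
  fix u :: real
  let ?X = "\<Prod>i = 1..Suc a. x i"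
  let ?c = "(\<delta> + real k * u\<^sup>2) / 2"
  let ?Z = "?X * (fact a / (\<delta> / 2) ^ Suc a)"
  let ?K = "real k ^ Suc b * u ^ (2 * b + 1) / (fact b * 2 ^ b) * ?X / ?Z"
  have c: "0 < ?c" using \<delta>(2) by (simp add: add_pos_nonneg)
  have "(LBINT s:{0<..}. hybrid_likelihood n r T x s * (1 / s))
      = (LBINT s:{0<..}. ?X * (exp (- (\<delta> / 2 / s)) / s ^ (a + 2)))"
    by (intro set_lebesgue_integral_cong)
       (auto simp: hybrid_likelihood_def d \<delta> mult_ac simp del: prod.cl_ivl_Suc)
  also have "\<dots> = ?Z"
    using integral_inverse_gamma[of "\<delta> / 2" a] \<delta>(2) by (simp only: set_integral_mult_right half_gt_zero)
  finally have Z: "(LBINT s:{0<..}. hybrid_likelihood n r T x s * (1 / s)) = ?Z" .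
  have gamma: "Gamma (real (Suc b)) = fact b"
    using Gamma_fact[of b, where 'a = real] by (simp add: add_ac)
  have "predictive_density n r T x (Suc b) k u
      = (LBINT \<sigma>:{0<..}. ?K * (exp (- (?c / \<sigma>)) / \<sigma> ^ (Suc (a + b) + 2)))"
    unfolding predictive_density_def
  proof (intro set_lebesgue_integral_cong ballI allI impI)
    fix \<sigma> :: real assume "\<sigma> \<in> {0<..}"
    then have \<sigma>: "0 < \<sigma>" by simp
    have e: "exp (- (?c / \<sigma>)) = exp (- (real k * u\<^sup>2 / (2 * \<sigma>))) * exp (- (1 / (2 * \<sigma>)) * \<delta>)"
      using \<sigma> by (simp add: exp_add[symmetric] field_simps)
    have "repair_density (Suc b) k \<sigma> u
        = real k ^ Suc b * u ^ (2 * b + 1) / (fact b * \<sigma> ^ Suc b * 2 ^ b)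
          * exp (- (real k * u\<^sup>2 / (2 * \<sigma>)))"
      by (simp add: repair_density_def gamma del: of_nat_Suc)
    moreover have "posterior (hybrid_likelihood n r T x) (\<lambda>s. 1 / s) \<sigma>
        = 1 / \<sigma> ^ Suc a * ?X * exp (- (1 / (2 * \<sigma>)) * \<delta>) * (1 / \<sigma>) / ?Z"
      unfolding posterior_def Z by (simp only: hybrid_likelihood_def d \<delta>(1))
    ultimately show "repair_density (Suc b) k \<sigma> u * posterior (hybrid_likelihood n r T x) (\<lambda>s. 1 / s) \<sigma>
        = ?K * (exp (- (?c / \<sigma>)) / \<sigma> ^ (Suc (a + b) + 2))"
      unfolding e using \<sigma> by (simp add: power_add mult_ac del: prod.cl_ivl_Suc)
  qed simp
  also have "\<dots> = ?K * (fact (Suc (a + b)) / ?c ^ (a + b + 2))"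
    unfolding set_integral_mult_right integral_inverse_gamma[OF c] by simp
  also have "\<dots> = real k ^ Suc b * u ^ (2 * b + 1) / (fact b * 2 ^ b)
      * (\<delta> / 2) ^ Suc a / fact a * (fact (Suc (a + b)) / ?c ^ (a + b + 2))"
    using less_imp_neq[OF x_pos] by (simp del: prod.cl_ivl_Suc prod_zero_iff fact_Suc)
  also have "\<dots> = 2 * real k ^ Suc b * \<delta> ^ Suc a / Beta (Suc a) (Suc b)
      * (u ^ (2 * b + 1) / (\<delta> + real k * u\<^sup>2) ^ (a + b + 2))"
    unfolding Beta_Suc power_divide by (simp add: power_add del: fact_Suc)
  finally show "predictive_density n r T x (Suc b) k u = \<dots>" .
qed

section \<open>The distribution function via the beta integral\<close>

lemma beta_antiderivative:
  obtains P :: "real \<Rightarrow> real" where "\<And>t. (P has_real_derivative t ^ a * (1 - t) ^ b) (at t)"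
    and "P 1 - P 0 = Beta (real (Suc a)) (real (Suc b))"
proof -
  let ?g = "\<lambda>t::real. t ^ a * (1 - t) ^ b"
  obtain P where P: "\<And>t. (P has_vector_derivative ?g t) (at t)"
    using einterval_antiderivative[of "-\<infinity>" \<infinity> ?g] by auto
  have "(?g has_integral P 1 - P 0) {0<..<1}"
    using fundamental_theorem_of_calculus[of 0 1 P ?g] P
    by (simp add: has_vector_derivative_at_within has_integral_Icc_iff_Ioo)
  moreover have "(?g has_integral Beta (real (Suc a)) (real (Suc b))) {0<..<1}"
  proof -
    have "((\<lambda>t. t powr (real (Suc a) - 1) * (1 - t) powr (real (Suc b) - 1))
        has_integral Beta (real (Suc a)) (real (Suc b))) {0<..<1}"
      using has_integral_Beta_real[of "real (Suc a)" "real (Suc b)"]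
      by (simp add: has_integral_Icc_iff_Ioo)
    then show ?thesis
      by (rule has_integral_eq[rotated]) (simp add: powr_realpow)
  qed
  ultimately have "P 1 - P 0 = Beta (real (Suc a)) (real (Suc b))"
    by (rule has_integral_unique)
  with P show ?thesis
    by (intro that) (simp_all only: has_real_derivative_iff_has_vector_derivative)
qed

section \<open>Positivity of the censored data\<close>

lemma hybrid_d_le: "hybrid_d r T x \<le> r"
  unfolding hybrid_d_def by (rule Max.boundedI) auto

lemma hybrid_delta_pos:
  assumes "r \<le> n" "\<forall>i\<in>{1..n}. 0 < x i" "1 \<le> hybrid_d r T x"
  shows "0 < hybrid_delta n r T x" and "0 < (\<Prod>i = 1..hybrid_d r T x. x i)"
proof -
  have le: "hybrid_d r T x \<le> n" using hybrid_d_le[of r T x] assms(1) by simp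
  have x: "0 < x i" if "i \<in> {1..hybrid_d r T x}" for i using assms(2) le that by auto
  show "0 < (\<Prod>i = 1..hybrid_d r T x. x i)" using x by (rule prod_pos)
  have "0 < (\<Sum>i = 1..hybrid_d r T x. (x i)\<^sup>2)"
    using x assms(3) by (intro sum_pos) (auto simp: less_imp_neq[symmetric])
  moreover have "0 \<le> (real n - real (hybrid_d r T x)) * (hybrid_T0 r T x)\<^sup>2"
    using le by simp
  ultimately show "0 < hybrid_delta n r T x" unfolding hybrid_delta_def by linarith
qed


section \<open>Unimodality and the highest density interval\<close>

text \<open>
  The logarithmic derivative of the density has the sign of
  \<open>(2 * b + 1) * \<delta> - (2 * a + 3) * \<kappa> * u\<^sup>2\<close>, which changes once, from positive to negative, at the
  stated mode. That \<open>F\<close> is an antiderivative is the substitution \<open>t = \<delta> / (\<delta> + \<kappa> * u\<^sup>2)\<close>, for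
  which \<open>1 - t = \<kappa> * u\<^sup>2 / (\<delta> + \<kappa> * u\<^sup>2)\<close>. It reverses the order: as \<open>u\<close> increases from \<open>0\<close>, \<open>t\<close>
  decreases from \<open>1\<close>.
\<close>

lemma unimodal_density_beta_prime:
  fixes \<delta> \<kappa> :: real
  assumes "0 < \<delta>" "0 < \<kappa>"
    and P: "\<And>t. (P has_real_derivative t ^ a * (1 - t) ^ b) (at t)"
    and P_Beta: "P 1 - P 0 = Beta (real (Suc a)) (real (Suc b))"
  shows "unimodal_density
    (\<lambda>u. 2 * \<kappa> ^ Suc b * \<delta> ^ Suc a / Beta (Suc a) (Suc b)
      * (u ^ (2 * b + 1) / (\<delta> + \<kappa> * u\<^sup>2) ^ (a + b + 2)))
    (\<lambda>u. (P 1 - P (\<delta> / (\<delta> + \<kappa> * u\<^sup>2))) / Beta (Suc a) (Suc b))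
    (sqrt ((2 * real b + 1) * \<delta> / ((2 * real a + 3) * \<kappa>)))"
proof -
  let ?B = "Beta (real (Suc a)) (real (Suc b))"
  define q where "q u = \<delta> + \<kappa> * u\<^sup>2" for u
  define g where "g u = u ^ (2 * b + 1) / q u ^ (a + b + 2)" for u
  define C where "C = 2 * \<kappa> ^ Suc b * \<delta> ^ Suc a / ?B"
  define F where "F u = (P 1 - P (\<delta> / q u)) / ?B" for u
  define M where "M = sqrt ((2 * real b + 1) * \<delta> / ((2 * real a + 3) * \<kappa>))"
  have B: "0 < ?B" unfolding Beta_Suc by simp
  have C: "0 < C" using B assms(1,2) by (simp add: C_def)
  have q: "0 < q u" for u
    using assms(1,2) by (simp add: q_def add_pos_nonneg)
  have q_deriv: "(q has_real_derivative 2 * \<kappa> * u) (at u)" for u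
    unfolding q_def by (auto intro!: derivative_eq_intros)
  have M_pos: "0 < M" using assms(1,2) by (simp add: M_def add_pos_nonneg)
  have M_less: "u < M \<longleftrightarrow> (2 * real a + 3) * \<kappa> * u\<^sup>2 < (2 * real b + 1) * \<delta>"
    and M_greater: "M < u \<longleftrightarrow> (2 * real b + 1) * \<delta> < (2 * real a + 3) * \<kappa> * u\<^sup>2" if "0 < u" for u
  proof -
    have D: "0 < (2 * real a + 3) * \<kappa>" using assms(2) by (simp add: add_pos_nonneg)
    have "u = sqrt (u\<^sup>2)" using that by simp
    then have "u < M \<longleftrightarrow> u\<^sup>2 < (2 * real b + 1) * \<delta> / ((2 * real a + 3) * \<kappa>)"
      "M < u \<longleftrightarrow> (2 * real b + 1) * \<delta> / ((2 * real a + 3) * \<kappa>) < u\<^sup>2"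
      unfolding M_def by (metis real_sqrt_less_iff)+
    then show "u < M \<longleftrightarrow> (2 * real a + 3) * \<kappa> * u\<^sup>2 < (2 * real b + 1) * \<delta>"
      "M < u \<longleftrightarrow> (2 * real b + 1) * \<delta> < (2 * real a + 3) * \<kappa> * u\<^sup>2"
      using D by (simp_all only: pos_less_divide_eq pos_divide_less_eq mult.commute)
  qed
  have g_deriv: "(g has_real_derivative
      u ^ (2 * b) * ((2 * real b + 1) * \<delta> - (2 * real a + 3) * \<kappa> * u\<^sup>2) / q u ^ (a + b + 3)) (at u)" for u
  proof -
    have "(g has_real_derivative
        (real (2 * b + 1) * u ^ (2 * b) * q u ^ (a + b + 2)
          - u ^ (2 * b + 1) * (real (a + b + 2) * q u ^ (a + b + 1) * (2 * \<kappa> * u)))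
        / (q u ^ (a + b + 2) * q u ^ (a + b + 2))) (at u)"
    proof -
      have "((\<lambda>u. u ^ (2 * b + 1)) has_real_derivative real (2 * b + 1) * u ^ (2 * b)) (at u)"
        using DERIV_pow[of "2 * b + 1" u UNIV] by simp
      moreover have "((\<lambda>u. q u ^ (a + b + 2)) has_real_derivative
          real (a + b + 2) * q u ^ (a + b + 1) * (2 * \<kappa> * u)) (at u)"
        using DERIV_power[OF q_deriv, of "a + b + 2" u] by (simp add: algebra_simps)
      ultimately show ?thesis
        unfolding g_def using q[of u]
        by (auto dest: DERIV_divide simp: mult_ac)
    qed
    also have "(real (2 * b + 1) * u ^ (2 * b) * q u ^ (a + b + 2)
          - u ^ (2 * b + 1) * (real (a + b + 2) * q u ^ (a + b + 1) * (2 * \<kappa> * u)))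
        = u ^ (2 * b) * q u ^ (a + b + 1) * ((2 * real b + 1) * q u - 2 * (real a + real b + 2) * \<kappa> * u\<^sup>2)"
      by (simp add: power2_eq_square algebra_simps)
    also have "(2 * real b + 1) * q u - 2 * (real a + real b + 2) * \<kappa> * u\<^sup>2
        = (2 * real b + 1) * \<delta> - (2 * real a + 3) * \<kappa> * u\<^sup>2"
      by (simp add: q_def algebra_simps)
    also have "u ^ (2 * b) * q u ^ (a + b + 1) * ((2 * real b + 1) * \<delta> - (2 * real a + 3) * \<kappa> * u\<^sup>2)
          / (q u ^ (a + b + 2) * q u ^ (a + b + 2))
        = u ^ (2 * b) * ((2 * real b + 1) * \<delta> - (2 * real a + 3) * \<kappa> * u\<^sup>2) / q u ^ (a + b + 3)"
    proof -
      have "q u ^ (a + b + 2) * q u ^ (a + b + 2) = q u ^ (a + b + 1) * q u ^ (a + b + 3)"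
        unfolding power_add[symmetric] by (rule arg_cong[where f = "\<lambda>i. q u ^ i"]) simp
      then show ?thesis using q[of u] by (simp only:) simp
    qed
    finally show ?thesis .
  qed
  have g_cont: "isCont g u" for u using g_deriv by (rule DERIV_isCont)
  have g_incr: "g u < g v" if "0 < u" "u < v" "v \<le> M" for u v
  proof (rule DERIV_pos_imp_increasing_open[OF that(2)])
    show "continuous_on {u..v} g" using g_cont by (simp add: continuous_at_imp_continuous_on)
    fix w assume w: "u < w" "w < v"
    then have "0 < w" "w < M" using that by auto
    then have "0 < w ^ (2 * b) * ((2 * real b + 1) * \<delta> - (2 * real a + 3) * \<kappa> * w\<^sup>2) / q w ^ (a + b + 3)"
      using M_less[of w] q[of w] by simp
    then show "\<exists>y. (g has_real_derivative y) (at w) \<and> 0 < y" using g_deriv by blast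
  qed
  have g_decr: "g v < g u" if "M \<le> u" "u < v" for u v
  proof (rule DERIV_neg_imp_decreasing_open[OF that(2)])
    show "continuous_on {u..v} g" using g_cont by (simp add: continuous_at_imp_continuous_on)
    fix w assume w: "u < w" "w < v"
    then have "0 < w" "M < w" using that M_pos by auto
    then have "w ^ (2 * b) * ((2 * real b + 1) * \<delta> - (2 * real a + 3) * \<kappa> * w\<^sup>2) / q w ^ (a + b + 3) < 0"
      using M_greater[of w] q[of w] by (simp add: divide_less_0_iff mult_less_0_iff)
    then show "\<exists>y. (g has_real_derivative y) (at w) \<and> y < 0" using g_deriv by blast
  qed
  have q_inf: "filterlim q at_top at_top"
    unfolding q_def using assms(2)
    by (intro filterlim_tendsto_add_at_top[OF tendsto_const]
        filterlim_tendsto_pos_mult_at_top[OF tendsto_const] filterlim_pow_at_top filterlim_ident) auto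
  have inv_q: "((\<lambda>u. c / q u) \<longlongrightarrow> 0) at_top" for c
    by (intro tendsto_divide_0[OF tendsto_const] filterlim_at_top_imp_at_infinity q_inf)
  have F_deriv: "(F has_real_derivative C * g u) (at u)" for u
  proof -
    have "((\<lambda>u. \<delta> / q u) has_real_derivative - (\<delta> * (2 * \<kappa> * u)) / (q u * q u)) (at u)"
      using DERIV_divide[OF DERIV_const q_deriv, of u \<delta>] q[of u] by (simp add: mult_ac)
    from DERIV_chain2[OF P this]
    have "(F has_real_derivative
        - ((\<delta> / q u) ^ a * (1 - \<delta> / q u) ^ b * (- (\<delta> * (2 * \<kappa> * u)) / (q u * q u))) / ?B) (at u)"
      unfolding F_def using B by (auto intro!: derivative_eq_intros)
    also have "1 - \<delta> / q u = \<kappa> * u\<^sup>2 / q u"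
      using q[of u] by (simp add: q_def field_simps)
    also have "- ((\<delta> / q u) ^ a * (\<kappa> * u\<^sup>2 / q u) ^ b * (- (\<delta> * (2 * \<kappa> * u)) / (q u * q u))) / ?B
        = C * g u"
      using q[of u]
      by (simp add: C_def g_def power_divide power_mult_distrib power_add power_mult power2_eq_square mult_ac)
    finally show ?thesis .
  qed
  have "unimodal_density (\<lambda>u. C * g u) F M"
  proof
    show "0 < M" by (fact M_pos)
    fix u :: real
    show "(F has_real_derivative C * g u) (at u)" by (fact F_deriv)
    show "isCont (\<lambda>u. C * g u) u" using g_cont by (intro continuous_intros)
    show "0 < C * g u" if "0 < u" using that C q[of u] by (simp add: g_def)
    show "C * g u < C * g v" if "0 < u" "u < v" "v \<le> M" for v using g_incr[OF that] C by simp
    show "C * g v < C * g u" if "M \<le> u" "u < v" for v using g_decr[OF that] C by simp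
  next
    have "g 0 = 0" by (simp add: g_def)
    then have "(g \<longlongrightarrow> 0) (at_right 0)"
      using g_cont[of 0] unfolding isCont_def by (auto intro: tendsto_within_subset)
    then show "((\<lambda>u. C * g u) \<longlongrightarrow> 0) (at_right 0)" by (rule tendsto_mult_right_zero)
    have "F 0 = 0" using assms(1) by (simp add: F_def q_def)
    then show "(F \<longlongrightarrow> 0) (at_right 0)"
      using DERIV_isCont[OF F_deriv[of 0]] unfolding isCont_def by (auto intro: tendsto_within_subset)
    have "((\<lambda>u. P (\<delta> / q u)) \<longlongrightarrow> P 0) at_top"
      using DERIV_isCont[OF P] inv_q by (rule isCont_tendsto_compose)
    then have "(F \<longlongrightarrow> (P 1 - P 0) / ?B) at_top"
      unfolding F_def using B by (intro tendsto_intros) auto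
    then show "(F \<longlongrightarrow> 1) at_top" using B P_Beta by simp
    \<comment> \<open>The denominator has larger degree than the numerator, so a bound by a multiple of \<open>1 / u\<close> is enough.\<close>
    have g_bound: "norm (g u) \<le> 1 / \<kappa> ^ (a + b + 2) * (1 / u)" if "1 \<le> u" for u
    proof -
      have "\<kappa> ^ (a + b + 2) * u ^ (2 * b + 1) * u = \<kappa> ^ (a + b + 2) * u ^ (2 * b + 2)"
        by simp
      also have "\<dots> \<le> \<kappa> ^ (a + b + 2) * u ^ (2 * (a + b + 2))"
        using that assms(2) by (intro mult_left_mono power_increasing) auto
      also have "\<dots> = (\<kappa> * u\<^sup>2) ^ (a + b + 2)"
        unfolding power_mult power_mult_distrib ..
      also have "\<dots> \<le> q u ^ (a + b + 2)"
        unfolding q_def using assms(1,2) by (intro power_mono) auto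
      finally show ?thesis
        using that q[of u] assms(2) by (simp add: g_def field_simps)
    qed
    have "((\<lambda>u. 1 / \<kappa> ^ (a + b + 2) * (1 / u)) \<longlongrightarrow> 0) at_top"
      by (intro tendsto_mult_right_zero tendsto_divide_0[OF tendsto_const]
          filterlim_at_top_imp_at_infinity filterlim_ident)
    then have "(g \<longlongrightarrow> 0) at_top"
      using g_bound by (elim Lim_null_comparison[rotated]) (auto intro: eventually_at_top_linorderI)
    then show "((\<lambda>u. C * g u) \<longlongrightarrow> 0) at_top" by (rule tendsto_mult_right_zero)
  qed
  then show ?thesis by (simp only: C_def g_def F_def[abs_def] M_def q_def)
qed

lemma beta_interval_integral:
  fixes v w :: real
  assumes "\<And>t. (P has_real_derivative t ^ a * (1 - t) ^ b) (at t)"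
  shows "(LBINT t=v..w. t ^ a * (1 - t) ^ b) = P w - P v"
proof (rule interval_integral_FTC_finite)
  show "continuous_on {min v w..max v w} (\<lambda>t. t ^ a * (1 - t) ^ b)"
    by (intro continuous_intros)
  show "(P has_vector_derivative t ^ a * (1 - t) ^ b) (at t within {min v w..max v w})" for t
    using assms[of t]
    by (simp add: has_real_derivative_iff_has_vector_derivative has_vector_derivative_at_within)
qed

theorem mainTheorem3:
  fixes n r m k :: nat and T \<alpha> :: real and x :: "nat \<Rightarrow> real"
  assumes "1 \<le> r" "r \<le> n" "0 < T"
    and "\<forall>i\<in>{1..n}. 0 < x i" "strict_mono_on {1..n} x"
    and "1 \<le> hybrid_d r T x"
    and "1 \<le> m" "1 \<le> k" "0 < \<alpha>" "\<alpha> < 1"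
  shows "unimodal_on {0<..} (predictive_density n r T x m k) \<and>
    (\<exists>w1 w2. 0 < w1 \<and> w1 < w2 \<and>
      (\<forall>I. is_HPD_interval {0<..} (predictive_density n r T x m k) (1 - \<alpha>) I \<longleftrightarrow>
             {w1<..<w2} \<subseteq> I \<and> I \<subseteq> {w1..w2}) \<and>
      (\<forall>v1 v2. 0 < v1 \<and> v1 < v2 \<longrightarrow>
         (1 / Beta (real (hybrid_d r T x)) (real m) *
              (LBINT t=p_fun n r T x k v2..p_fun n r T x k v1.
                 t ^ (hybrid_d r T x - 1) * (1 - t) ^ (m - 1)) = 1 - \<alpha> \<and>
          (v1 / v2) ^ (2 * m - 1) =
            ((hybrid_delta n r T x + real k * v1\<^sup>2) / (hybrid_delta n r T x + real k * v2\<^sup>2))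
              ^ (hybrid_d r T x + m)
          \<longleftrightarrow> v1 = w1 \<and> v2 = w2)))"
proof -
  obtain a where a: "hybrid_d r T x = Suc a" using assms(6) by (cases "hybrid_d r T x") auto
  obtain b where b: "m = Suc b" using assms(7) by (cases m) auto
  define \<delta> where "\<delta> = hybrid_delta n r T x"
  have \<delta>: "0 < \<delta>" and x_pos: "0 < (\<Prod>i = 1..Suc a. x i)"
    using hybrid_delta_pos[OF assms(2,4,6)] by (simp_all only: \<delta>_def a)
  obtain P where P: "\<And>t. (P has_real_derivative t ^ a * (1 - t) ^ b) (at t)"
    and P_Beta: "P 1 - P 0 = Beta (real (Suc a)) (real (Suc b))"
    using beta_antiderivative by blast
  define q where "q u = \<delta> + real k * u\<^sup>2" for u
  define C where "C = 2 * real k ^ Suc b * \<delta> ^ Suc a / Beta (Suc a) (Suc b)"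
  define f where "f = predictive_density n r T x m k"
  define F where "F u = (P 1 - P (\<delta> / q u)) / Beta (Suc a) (Suc b)" for u
  have f: "f = (\<lambda>u. C * (u ^ (2 * b + 1) / q u ^ (a + b + 2)))"
    unfolding f_def b C_def q_def
    by (rule predictive_density_eq[OF a \<delta>_def[symmetric] \<delta> x_pos])
  have q: "0 < q u" for u using \<delta> by (simp add: q_def add_pos_nonneg)
  have C: "0 < C" unfolding C_def Beta_Suc using \<delta> assms(8) by simp
  have "unimodal_density f F (sqrt ((2 * real b + 1) * \<delta> / ((2 * real a + 3) * real k)))"
    unfolding f F_def C_def q_def
    by (rule unimodal_density_beta_prime[OF \<delta> _ P P_Beta]) (use assms(8) in simp)
  then interpret unimodal_density f F "sqrt ((2 * real b + 1) * \<delta> / ((2 * real a + 3) * real k))" .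
  have mass: "1 / Beta (real (hybrid_d r T x)) (real m) *
      (LBINT t=p_fun n r T x k v..p_fun n r T x k u.
        t ^ (hybrid_d r T x - 1) * (1 - t) ^ (m - 1)) = F v - F u" for u v
    unfolding a b p_fun_def \<delta>_def[symmetric] q_def[symmetric]
    by (simp add: beta_interval_integral[OF P] F_def diff_divide_distrib)
  have ends: "(u / v) ^ (2 * m - 1)
      = ((hybrid_delta n r T x + real k * u\<^sup>2) / (hybrid_delta n r T x + real k * v\<^sup>2))
          ^ (hybrid_d r T x + m) \<longleftrightarrow> f u = f v" if "0 < u" "u < v" for u v
  proof -
    have "(u / v) ^ (2 * b + 1) = (q u / q v) ^ (a + b + 2) \<longleftrightarrow>
        u ^ (2 * b + 1) / q u ^ (a + b + 2) = v ^ (2 * b + 1) / q v ^ (a + b + 2)"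
      using that q[of u] q[of v] unfolding power_divide
      by (subst (1 2) frac_eq_eq) (auto simp: mult_ac)
    also have "\<dots> \<longleftrightarrow> f u = f v"
      using less_imp_neq[OF C] unfolding f mult_cancel_left by blast
    finally show ?thesis
      unfolding a b \<delta>_def[symmetric] q_def[symmetric] by simp
  qed
  obtain w1 w2 where w: "0 < w1" "w1 < w2"
    and HPD: "\<And>I. is_HPD_interval {0<..} f (1 - \<alpha>) I \<longleftrightarrow> {w1<..<w2} \<subseteq> I \<and> I \<subseteq> {w1..w2}"
    and sol: "\<And>u v. 0 < u \<Longrightarrow> u < v \<Longrightarrow> F v - F u = 1 - \<alpha> \<and> f u = f v \<longleftrightarrow> u = w1 \<and> v = w2"
    using HPD_interval[of "1 - \<alpha>"] assms(9,10) by auto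
  show ?thesis
    unfolding f_def[symmetric] mass
  proof (intro conjI exI allI impI)
    show "unimodal_on {0<..} f" by (fact unimodal)
    show "0 < w1" "w1 < w2" by (fact w)+
    show "is_HPD_interval {0<..} f (1 - \<alpha>) I \<longleftrightarrow> {w1<..<w2} \<subseteq> I \<and> I \<subseteq> {w1..w2}" for I
      by (fact HPD)
    fix v1 v2 :: real assume "0 < v1 \<and> v1 < v2"
    then have v: "0 < v1" "v1 < v2" by auto
    show "F v2 - F v1 = 1 - \<alpha> \<and>
        (v1 / v2) ^ (2 * m - 1) =
          ((hybrid_delta n r T x + real k * v1\<^sup>2) / (hybrid_delta n r T x + real k * v2\<^sup>2))
            ^ (hybrid_d r T x + m)
        \<longleftrightarrow> v1 = w1 \<and> v2 = w2"
      unfolding ends[OF v] by (rule sol[OF v])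
  qed
qed

end
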